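(* Let $G=(V,E)$ be the graph of a Q2R network with $n=|V|$ even and every vertex of positive even degree, and let $V=A\sqcup B$ with $A$ and $B$ non-empty. Let $\Phi:\{-1,1\}^V\to\{-1,1\}^V$ be one time step of the Q2R rule on $G$ under the block-sequential update $s=(A)(B)$, let $H$ be the Parallel Simulator graph of $(G,A,B)$, let $P:\{-1,1\}^{V(H)}\to\{-1,1\}^{V(H)}$ be one step of the Q2R rule on $H$ under the parallel update, and for $x\in\{-1,1\}^V$ let $X(x)\in\{-1,1\}^{V(H)}$ be the associated initial configuration of the Parallel Simulator. Then one time step of $G$ under $s=(A)(B)$ corresponds to two parallel time steps of the Parallel Simulator: for every $x\in\{-1,1\}^V$ and every integer $T\ge 0$, $$\big(P^{2T}(X(x))\big)\big|_{V}=\Phi^{T}(x).$$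
   Context: Q2R rule. For a finite simple undirected graph $K$ with all degrees even and $y\in\{-1,1\}^{V(K)}$, the local rule at a vertex $i$ is $$f_i(y)=\begin{cases}-y_i & \text{if }\sum_{j\in N(i)}y_j=0,\\ y_i&\text{otherwise,}\end{cases}$$ with $N(i)$ the set of neighbors of $i$ in $K$. The parallel update applies $f_i$ simultaneously to all vertices of $K$. The block-sequential update $s=(A)(B)$ first applies $f_i$ simultaneously to all $i\in A$, and then, on the resulting configuration, applies $f_i$ simultaneously to all $i\in B$; the two together form one time step. The graph of a Q2R network is a finite simple undirected bipartite graph with all degrees even. Parallel Simulator. Let $d(w)$ denote the degree of $w$ in $G$ and $\alpha=\frac12\max\{d(w):w\in V\}$. The graph $H$ is made of four components plus connecting edges. - Input component: the graph $G$ itself, on $V$. - Gear component: a disjoint copy $\overline G$ of $G$, on vertices $\overline w$ for $w\in V$, with $\overline w\,\overline z$ an edge if and only if $wz\in E$. - Switching component: for each $i\in\{1,\dots,\alpha\}$, a 4-cycle $S^i$ on vertices $s^i_1,s^i_2,s^i_3,s^i_4$ with edges $s^i_1s^i_2,\ s^i_2s^i_3,\ s^i_3s^i_4,\ s^i_4s^i_1$. - Fixed component: for each $i\in\{1,\dots,\alpha\}$, a 4-cycle $F^i$ on vertices $f^i_1,f^i_2,f^i_3,f^i_4$ with edges $f^i_1f^i_2,\ f^i_2f^i_3,\ f^i_3f^i_4,\ f^i_4f^i_1$. The connecting edges are: - for each $u\in A$ and each $i\in\{1,\dots,d(u)/2\}$, edges joining each of $u$ and $\overline u$ to each of $s^i_3,\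 s^i_4,\ f^i_1,\ f^i_4$; - for each $v\in B$ and each $i\in\{1,\dots,d(v)/2\}$, edges joining each of $v$ and $\overline v$ to each of $s^i_1,\ s^i_2,\ f^i_2,\ f^i_3$. Initial configuration $X(x)$ for $x\in\{-1,1\}^V$: $X_w=x_w$ and $X_{\overline w}=-x_w$ for $w\in V$; and for all $i\in\{1,\dots,\alpha\}$: $X_{s^i_1}=X_{s^i_2}=-1$, $X_{s^i_3}=X_{s^i_4}=+1$, and $X_{f^i_1}=X_{f^i_2}=X_{f^i_3}=X_{f^i_4}=-1$. *)

theory Defs
  imports "HOL-Library.FuncSet"
begin

definition simple_graph :: "'v set \<Rightarrow> 'v set set \<Rightarrow> bool" where
  "simple_graph V E \<longleftrightarrow> finite V \<and> (\<forall>e\<in>E. e \<subseteq> V \<and> card e = 2)"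

definition neighbors :: "'v set set \<Rightarrow> 'v \<Rightarrow> 'v set" where
  "neighbors E i = {j. {i, j} \<in> E}"

definition degree :: "'v set set \<Rightarrow> 'v \<Rightarrow> nat" where
  "degree E i = card (neighbors E i)"

definition bipartite :: "'v set \<Rightarrow> 'v set set \<Rightarrow> bool" where
  "bipartite V E \<longleftrightarrow>
     (\<exists>L R. L \<union> R = V \<and> L \<inter> R = {} \<and> (\<forall>e\<in>E. \<exists>l\<in>L. \<exists>r\<in>R. e = {l, r}))"

definition q2r_graph :: "'v set \<Rightarrow> 'v set set \<Rightarrow> bool" where
  "q2r_graph V E \<longleftrightarrow> simple_graph V E \<and> bipartite V E \<and> (\<forall>i\<in>V. even (degree E i))"

text \<open>A configuration of a graph with vertex set \<open>V\<close> is an element of \<open>configs V\<close>. It is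
  extensional (\<open>undefined\<close> outside \<open>V\<close>), so equality of configurations is equality of functions.\<close>

definition configs :: "'v set \<Rightarrow> ('v \<Rightarrow> int) set" where
  "configs V = V \<rightarrow>\<^sub>E {-1, 1}"

definition q2r_rule :: "'v set set \<Rightarrow> 'v \<Rightarrow> ('v \<Rightarrow> int) \<Rightarrow> int" where
  "q2r_rule E i y = (if (\<Sum>j\<in>neighbors E i. y j) = 0 then - y i else y i)"

definition update_block :: "'v set \<Rightarrow> 'v set set \<Rightarrow> 'v set \<Rightarrow> ('v \<Rightarrow> int) \<Rightarrow> ('v \<Rightarrow> int)" where
  "update_block V E U y = (\<lambda>i\<in>V. if i \<in> U then q2r_rule E i y else y i)"

definition parallel_step :: "'v set \<Rightarrow> 'v set set \<Rightarrow> ('v \<Rightarrow> int) \<Rightarrow> ('v \<Rightarrow> int)" where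
  "parallel_step V E = update_block V E V"

definition block_seq_step ::
  "'v set \<Rightarrow> 'v set set \<Rightarrow> 'v set \<Rightarrow> 'v set \<Rightarrow> ('v \<Rightarrow> int) \<Rightarrow> ('v \<Rightarrow> int)" where
  "block_seq_step V E A B = update_block V E B \<circ> update_block V E A"

text \<open>\<open>Inp w\<close> is the vertex \<open>w\<close> of the input component, \<open>Gear w\<close> its copy in the gear component;
  \<open>Sw i k\<close> and \<open>Fx i k\<close> are the \<open>k\<close>-th vertices (\<open>k = 1, 2, 3, 4\<close>) of the \<open>i\<close>-th switching and
  fixed 4-cycles.\<close>

datatype 'v sim_vertex = Inp 'v | Gear 'v | Sw nat nat | Fx nat nat

text \<open>All degrees are even in the intended use, so the divisions by two below are exact.\<close>

definition alpha :: "'v set \<Rightarrow> 'v set set \<Rightarrow> nat" where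
  "alpha V E = Max (degree E ` V) div 2"

definition sim_verts :: "'v set \<Rightarrow> 'v set set \<Rightarrow> 'v sim_vertex set" where
  "sim_verts V E =
     Inp ` V \<union> Gear ` V
     \<union> {Sw i k | i k. i \<in> {1..alpha V E} \<and> k \<in> {1..4}}
     \<union> {Fx i k | i k. i \<in> {1..alpha V E} \<and> k \<in> {1..4}}"

definition cycle4 :: "(nat \<Rightarrow> 'w) \<Rightarrow> 'w set set" where
  "cycle4 c = {{c 1, c 2}, {c 2, c 3}, {c 3, c 4}, {c 4, c 1}}"

definition sim_edges :: "'v set \<Rightarrow> 'v set set \<Rightarrow> 'v set \<Rightarrow> 'v set \<Rightarrow> 'v sim_vertex set set" where
  "sim_edges V E A B =
     {{Inp w, Inp z} | w z. {w, z} \<in> E}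
     \<union> {{Gear w, Gear z} | w z. {w, z} \<in> E}
     \<union> (\<Union>i\<in>{1..alpha V E}. cycle4 (Sw i))
     \<union> (\<Union>i\<in>{1..alpha V E}. cycle4 (Fx i))
     \<union> (\<Union>u\<in>A. \<Union>i\<in>{1..degree E u div 2}.
          {{p, q} | p q. p \<in> {Inp u, Gear u} \<and> q \<in> {Sw i 3, Sw i 4, Fx i 1, Fx i 4}})
     \<union> (\<Union>v\<in>B. \<Union>i\<in>{1..degree E v div 2}.
          {{p, q} | p q. p \<in> {Inp v, Gear v} \<and> q \<in> {Sw i 1, Sw i 2, Fx i 2, Fx i 3}})"

definition sim_init :: "'v set \<Rightarrow> 'v set set \<Rightarrow> ('v \<Rightarrow> int) \<Rightarrow> ('v sim_vertex \<Rightarrow> int)" where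
  "sim_init V E x = (\<lambda>p\<in>sim_verts V E. case p of
       Inp w \<Rightarrow> x w
     | Gear w \<Rightarrow> - x w
     | Sw i k \<Rightarrow> (if k \<in> {1, 2} then -1 else 1)
     | Fx i k \<Rightarrow> -1)"

definition restrict_input :: "'v set \<Rightarrow> ('v sim_vertex \<Rightarrow> int) \<Rightarrow> ('v \<Rightarrow> int)" where
  "restrict_input V Y = (\<lambda>w\<in>V. Y (Inp w))"

end

theory Submission imports Defs begin

text \<open>The orbit of the initial configuration stays in a two-parameter family: the gear component is
  always the negative of the input component, and the switching cycles carry the pattern
  \<open>(-c, -c, c, c)\<close> for a sign \<open>c\<close>. Input and gear contributions cancel at every cycle vertex, so the
  switching cycles flip at each step and the fixed cycles never do. The cycles contribute
  \<open>0\<close> to one of the classes \<open>A\<close>, \<open>B\<close>, which is thus updated as in \<open>G\<close>, and \<open>-2d\<close> to a vertex of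
  degree \<open>d\<close> in the other class, which no sum of \<open>d\<close> signs can cancel; the sign \<open>c\<close> selects the class.\<close>

section \<open>Neighborhoods in copies of a graph and in disjoint 4-cycles\<close>

lemma neighbors_Un: "neighbors (E \<union> F) i = neighbors E i \<union> neighbors F i"
  by (auto simp: neighbors_def)

lemma neighbors_UN: "neighbors (\<Union>x\<in>I. E x) i = (\<Union>x\<in>I. neighbors (E x) i)"
  by (auto simp: neighbors_def)

lemma neighbors_copy:
  assumes "inj f"
  shows "neighbors {{f w, f z} | w z. {w, z} \<in> E} (f w) = f ` neighbors E w"
  using assms by (auto simp: neighbors_def doubleton_eq_iff inj_eq insert_commute)

lemma neighbors_copy_other:
  assumes "p \<notin> range f"
  shows "neighbors {{f w, f z} | w z. {w, z} \<in> E} p = {}"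
  using assms by (auto simp: neighbors_def doubleton_eq_iff)

text \<open>A 4-cycle is complete bipartite between its odd and its even positions, so the parity of
  \<open>k\<close> suffices.\<close>

definition cycle_nbrs :: "nat \<Rightarrow> nat set" where
  "cycle_nbrs k = (if odd k then {2, 4} else {1, 3})"

lemma neighbors_cycle4:
  assumes "inj c" "k \<in> {1..4}"
  shows "neighbors (cycle4 c) (c k) = c ` cycle_nbrs k"
proof -
  have "k = 1 \<or> k = 2 \<or> k = 3 \<or> k = 4" using assms(2) by auto
  then show ?thesis
    by (elim disjE)
      (auto simp: neighbors_def cycle4_def cycle_nbrs_def doubleton_eq_iff inj_eq[OF assms(1)])
qed

lemma neighbors_cycle4_other:
  assumes "p \<notin> range c"
  shows "neighbors (cycle4 c) p = {}"
  using assms by (auto simp: neighbors_def cycle4_def doubleton_eq_iff)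

text \<open>The second assumption makes the cycles vertex-disjoint, so only the \<open>i\<close>-th
  one contributes. A generic \<open>c\<close> serves both \<open>Sw\<close> and
  \<open>Fx\<close>.\<close>

lemma neighbors_cycles4:
  assumes "\<And>i. inj (c i)" "\<And>i j k l. c i k = c j l \<Longrightarrow> i = j" "i \<in> I" "k \<in> {1..4}"
  shows "neighbors (\<Union>i\<in>I. cycle4 (c i)) (c i k) = c i ` cycle_nbrs k"
proof -
  have "neighbors (cycle4 (c j)) (c i k) = (if j = i then c i ` cycle_nbrs k else {})" for j
  proof (cases "j = i")
    case True
    then show ?thesis using neighbors_cycle4[OF assms(1,4)] by simp
  next
    case False
    then have "c i k \<notin> range (c j)" using assms(2) by blast
    then show ?thesis using False by (simp add: neighbors_cycle4_other)
  qed
  then show ?thesis using assms(3) by (simp add: neighbors_UN)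
qed

lemma neighbors_cycles4_other:
  assumes "\<And>i k. p \<noteq> c i k"
  shows "neighbors (\<Union>i\<in>I. cycle4 (c i)) p = {}"
  using assms by (auto simp: neighbors_UN neighbors_cycle4_other image_iff)

section \<open>Neighborhoods in the simulator graph\<close>

locale q2r_simulator =
  fixes V A B :: "'v set" and E :: "'v set set"
  assumes graph: "q2r_graph V E"
    and degree_pos: "w \<in> V \<Longrightarrow> degree E w > 0"
    and verts_split: "V = A \<union> B" and disj: "A \<inter> B = {}"
begin

lemma finite_verts: "finite V"
  using graph by (auto simp: q2r_graph_def simple_graph_def)

lemma neighbors_subset: "neighbors E w \<subseteq> V"
  using graph by (fastforce simp: q2r_graph_def simple_graph_def neighbors_def)

lemma finite_neighbors: "finite (neighbors E w)"
  using neighbors_subset finite_verts finite_subset by blast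

lemma even_degree: "w \<in> V \<Longrightarrow> even (degree E w)"
  using graph by (auto simp: q2r_graph_def)

text \<open>Guarantees that every link of \<open>w\<close> ends on an existing cycle, where the
  configuration has a defined value.\<close>

lemma half_degree_le_alpha: "w \<in> V \<Longrightarrow> degree E w div 2 \<le> alpha V E"
  unfolding alpha_def by (intro div_le_mono Max_ge) (auto simp: finite_verts)

text \<open>Under the pattern \<open>(-c, -c, c, c)\<close> a vertex of \<open>A\<close> sees only
  the sign \<open>c\<close> on these ports, and a vertex of \<open>B\<close> only
  \<open>-c\<close>.\<close>

definition switch_ports :: "'v \<Rightarrow> nat set" where
  "switch_ports w = (if w \<in> A then {3, 4} else {1, 2})"

definition fixed_ports :: "'v \<Rightarrow> nat set" where
  "fixed_ports w = (if w \<in> A then {1, 4} else {2, 3})"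

definition links :: "'v \<Rightarrow> 'v sim_vertex set" where
  "links w = (\<lambda>(i, k). Sw i k) ` ({1..degree E w div 2} \<times> switch_ports w)
     \<union> (\<lambda>(i, k). Fx i k) ` ({1..degree E w div 2} \<times> fixed_ports w)"

lemma mem_links:
  "Sw i k \<in> links w \<longleftrightarrow> i \<in> {1..degree E w div 2} \<and> k \<in> switch_ports w"
  "Fx i k \<in> links w \<longleftrightarrow> i \<in> {1..degree E w div 2} \<and> k \<in> fixed_ports w"
  "Inp z \<notin> links w"
  "Gear z \<notin> links w"
  by (auto simp: links_def)

lemma links_eq:
  "w \<in> A \<Longrightarrow> links w = (\<Union>i\<in>{1..degree E w div 2}. {Sw i 3, Sw i 4, Fx i 1, Fx i 4})"
  "w \<in> B \<Longrightarrow> links w = (\<Union>i\<in>{1..degree E w div 2}. {Sw i 1, Sw i 2, Fx i 2, Fx i 3})"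
  using disj by (auto simp: links_def switch_ports_def fixed_ports_def image_iff)

definition link_edges :: "'v sim_vertex set set" where
  "link_edges = (\<Union>w\<in>V. {{p, q} | p q. p \<in> {Inp w, Gear w} \<and> q \<in> links w})"

text \<open>Merges the connecting edges of \<open>A\<close> and \<open>B\<close> into one family
  over \<open>V\<close>, so that later arguments treat both classes at once.\<close>

lemma sim_edges_eq:
  "sim_edges V E A B =
     {{Inp w, Inp z} | w z. {w, z} \<in> E}
     \<union> {{Gear w, Gear z} | w z. {w, z} \<in> E}
     \<union> (\<Union>i\<in>{1..alpha V E}. cycle4 (Sw i))
     \<union> (\<Union>i\<in>{1..alpha V E}. cycle4 (Fx i))
     \<union> link_edges"
proof -
  have "(\<Union>w\<in>A. {{p, q} | p q. p \<in> {Inp w, Gear w} \<and> q \<in> links w})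
    = (\<Union>u\<in>A. \<Union>i\<in>{1..degree E u div 2}.
          {{p, q} | p q. p \<in> {Inp u, Gear u} \<and> q \<in> {Sw i 3, Sw i 4, Fx i 1, Fx i 4}})"
    by (intro SUP_cong refl) (simp only: links_eq, blast)
  moreover have "(\<Union>w\<in>B. {{p, q} | p q. p \<in> {Inp w, Gear w} \<and> q \<in> links w})
    = (\<Union>v\<in>B. \<Union>i\<in>{1..degree E v div 2}.
          {{p, q} | p q. p \<in> {Inp v, Gear v} \<and> q \<in> {Sw i 1, Sw i 2, Fx i 2, Fx i 3}})"
    by (intro SUP_cong refl) (simp only: links_eq, blast)
  ultimately show ?thesis
    unfolding sim_edges_def link_edges_def by (subst verts_split) (simp only: UN_Un Un_assoc)
qed

lemma doubleton_mem_link_edges: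
  "{p, q} \<in> link_edges \<longleftrightarrow>
    (\<exists>w\<in>V. p \<in> {Inp w, Gear w} \<and> q \<in> links w \<or> q \<in> {Inp w, Gear w} \<and> p \<in> links w)"
  unfolding link_edges_def by (auto simp: doubleton_eq_iff)

lemma neighbors_link_edges:
  "w \<in> V \<Longrightarrow> neighbors link_edges (Inp w) = links w"
  "w \<in> V \<Longrightarrow> neighbors link_edges (Gear w) = links w"
  "neighbors link_edges (Sw i k)
    = Inp ` {w \<in> V. Sw i k \<in> links w} \<union> Gear ` {w \<in> V. Sw i k \<in> links w}"
  "neighbors link_edges (Fx i k)
    = Inp ` {w \<in> V. Fx i k \<in> links w} \<union> Gear ` {w \<in> V. Fx i k \<in> links w}"
  by (auto simp: neighbors_def doubleton_mem_link_edges mem_links)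

lemma neighbors_sim_cycles:
  assumes "i \<in> {1..alpha V E}" "k \<in> {1..4}"
  shows "neighbors (\<Union>i\<in>{1..alpha V E}. cycle4 (Sw i)) (Sw i k) = Sw i ` cycle_nbrs k"
    and "neighbors (\<Union>i\<in>{1..alpha V E}. cycle4 (Fx i)) (Fx i k) = Fx i ` cycle_nbrs k"
  by (rule neighbors_cycles4[OF _ _ assms]; simp add: inj_on_def)+

lemma neighbors_sim_edges:
  "w \<in> V \<Longrightarrow> neighbors (sim_edges V E A B) (Inp w) = Inp ` neighbors E w \<union> links w"
  "w \<in> V \<Longrightarrow> neighbors (sim_edges V E A B) (Gear w) = Gear ` neighbors E w \<union> links w"
  "i \<in> {1..alpha V E} \<Longrightarrow> k \<in> {1..4} \<Longrightarrow> neighbors (sim_edges V E A B) (Sw i k)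
    = Sw i ` cycle_nbrs k
      \<union> (Inp ` {w \<in> V. Sw i k \<in> links w} \<union> Gear ` {w \<in> V. Sw i k \<in> links w})"
  "i \<in> {1..alpha V E} \<Longrightarrow> k \<in> {1..4} \<Longrightarrow> neighbors (sim_edges V E A B) (Fx i k)
    = Fx i ` cycle_nbrs k
      \<union> (Inp ` {w \<in> V. Fx i k \<in> links w} \<union> Gear ` {w \<in> V. Fx i k \<in> links w})"
  unfolding sim_edges_eq neighbors_Un
  by (simp_all add: neighbors_copy neighbors_copy_other neighbors_sim_cycles neighbors_cycles4_other
      neighbors_link_edges inj_on_def image_iff del: One_nat_def)

section \<open>Neighbor sums on the invariant family of configurations\<close>

definition sim_state :: "('v \<Rightarrow> int) \<Rightarrow> int \<Rightarrow> 'v sim_vertex \<Rightarrow> int" where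
  "sim_state y c = (\<lambda>p\<in>sim_verts V E. case p of
       Inp w \<Rightarrow> y w
     | Gear w \<Rightarrow> - y w
     | Sw i k \<Rightarrow> (if k \<in> {1, 2} then - c else c)
     | Fx i k \<Rightarrow> -1)"

lemma sim_state_simps:
  "w \<in> V \<Longrightarrow> sim_state y c (Inp w) = y w"
  "w \<in> V \<Longrightarrow> sim_state y c (Gear w) = - y w"
  "i \<in> {1..alpha V E} \<Longrightarrow> k \<in> {1..4} \<Longrightarrow>
    sim_state y c (Sw i k) = (if k \<in> {1, 2} then - c else c)"
  "i \<in> {1..alpha V E} \<Longrightarrow> k \<in> {1..4} \<Longrightarrow> sim_state y c (Fx i k) = -1"
  by (auto simp: sim_state_def sim_verts_def)

lemma sim_init_eq: "sim_init V E x = sim_state x 1"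
  unfolding sim_init_def sim_state_def ..

text \<open>Each of the \<open>d/2\<close> linked switching cycles shows \<open>w\<close> two equal
  signs, and each linked fixed cycle shows it -1 twice. For a sign \<open>c\<close> the total is
  therefore 0 or \<open>-2d\<close>.\<close>

lemma sum_links:
  assumes "w \<in> V"
  shows "sum (sim_state y c) (links w) = int (degree E w) * ((if w \<in> A then c else - c) - 1)"
proof -
  let ?I = "{1..degree E w div 2}"
  have I: "i \<in> {1..alpha V E}" if "i \<in> ?I" for i
    using that half_degree_le_alpha[OF assms] by auto
  have "sum (sim_state y c) (links w)
      = sum (sim_state y c) ((\<lambda>(i, k). Sw i k) ` (?I \<times> switch_ports w))
      + sum (sim_state y c) ((\<lambda>(i, k). Fx i k) ` (?I \<times> fixed_ports w))"
    unfolding links_def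
    by (rule sum.union_disjoint) (auto simp: switch_ports_def fixed_ports_def)
  also have "sum (sim_state y c) ((\<lambda>(i, k). Sw i k) ` (?I \<times> switch_ports w))
      = (\<Sum>(i, k)\<in>?I \<times> switch_ports w. if w \<in> A then c else - c)"
  proof (rule sum.reindex_cong[where l = "\<lambda>(i, k). Sw i k"])
    show "sim_state y c (case p of (i, k) \<Rightarrow> Sw i k) = (case p of (i, k) \<Rightarrow> if w \<in> A then c else - c)"
      if "p \<in> ?I \<times> switch_ports w" for p
      using that I by (auto simp: switch_ports_def sim_state_simps simp del: One_nat_def
          split: if_splits)
  qed (auto simp: inj_on_def)
  also have "sum (sim_state y c) ((\<lambda>(i, k). Fx i k) ` (?I \<times> fixed_ports w))
      = (\<Sum>(i, k)\<in>?I \<times> fixed_ports w. -1)"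
  proof (rule sum.reindex_cong[where l = "\<lambda>(i, k). Fx i k"])
    show "sim_state y c (case p of (i, k) \<Rightarrow> Fx i k) = (case p of (i, k) \<Rightarrow> -1)"
      if "p \<in> ?I \<times> fixed_ports w" for p
      using that I by (auto simp: fixed_ports_def sim_state_simps simp del: One_nat_def
          split: if_splits)
  qed (auto simp: inj_on_def)
  \<comment> \<open>With two ports per cycle there are \<open>2 * (d div 2)\<close> terms, which is
    \<open>d\<close> because the degree is even.\<close>
  also have "(\<Sum>(i, k)\<in>?I \<times> switch_ports w. if w \<in> A then c else - c)
      = int (degree E w) * (if w \<in> A then c else - c)"
    using even_degree[OF assms] by (auto simp: switch_ports_def card_cartesian_product elim!: evenE)
  also have "(\<Sum>(i, k)\<in>?I \<times> fixed_ports w. -1) = - int (degree E w)"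
    using even_degree[OF assms] by (auto simp: fixed_ports_def card_cartesian_product elim!: evenE)
  finally show ?thesis by (simp add: algebra_simps)
qed

lemma sum_Inp_neighbors:
  assumes "w \<in> V"
  shows "sum (sim_state y c) (neighbors (sim_edges V E A B) (Inp w))
    = sum y (neighbors E w) + int (degree E w) * ((if w \<in> A then c else - c) - 1)"
proof -
  have "sum (sim_state y c) (neighbors (sim_edges V E A B) (Inp w))
      = sum (sim_state y c) (Inp ` neighbors E w) + sum (sim_state y c) (links w)"
    unfolding neighbors_sim_edges(1)[OF assms]
    by (rule sum.union_disjoint)
      (auto simp: finite_neighbors links_def switch_ports_def fixed_ports_def)
  also have "sum (sim_state y c) (Inp ` neighbors E w) = sum y (neighbors E w)"
    using neighbors_subset by (subst sum.reindex) (auto simp: inj_on_def sim_state_simps subset_iff)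
  finally show ?thesis by (simp add: sum_links[OF assms])
qed

lemma sum_Gear_neighbors:
  assumes "w \<in> V"
  shows "sum (sim_state y c) (neighbors (sim_edges V E A B) (Gear w))
    = - sum y (neighbors E w) + int (degree E w) * ((if w \<in> A then c else - c) - 1)"
proof -
  have "sum (sim_state y c) (neighbors (sim_edges V E A B) (Gear w))
      = sum (sim_state y c) (Gear ` neighbors E w) + sum (sim_state y c) (links w)"
    unfolding neighbors_sim_edges(2)[OF assms]
    by (rule sum.union_disjoint)
      (auto simp: finite_neighbors links_def switch_ports_def fixed_ports_def)
  also have "sum (sim_state y c) (Gear ` neighbors E w) = - sum y (neighbors E w)"
    using neighbors_subset
    by (subst sum.reindex) (auto simp: inj_on_def sim_state_simps subset_iff sum_negf[symmetric])
  finally show ?thesis by (simp add: sum_links[OF assms])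
qed

text \<open>This cancellation is the purpose of the gear component: it makes the cycles evolve
  independently of \<open>y\<close>.\<close>

lemma sum_Inp_Gear:
  assumes "W \<subseteq> V"
  shows "sum (sim_state y c) (Inp ` W \<union> Gear ` W) = 0"
proof -
  have "finite W" using assms finite_verts finite_subset by blast
  then have "sum (sim_state y c) (Inp ` W \<union> Gear ` W)
      = sum (sim_state y c) (Inp ` W) + sum (sim_state y c) (Gear ` W)"
    by (intro sum.union_disjoint) auto
  also have "\<dots> = (\<Sum>w\<in>W. y w) + (\<Sum>w\<in>W. - y w)"
    using assms by (simp add: sum.reindex inj_on_def sim_state_simps subset_iff)
  finally show ?thesis by (simp add: sum_negf)
qed

text \<open>By the cancellation above only the two cycle neighbors count. They are positions 1, 3 or
  2, 4, which carry opposite signs on a switching cycle and -1 twice on a fixed one.\<close>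

lemma sum_cycle_neighbors:
  assumes i: "i \<in> {1..alpha V E}" and k: "k \<in> {1..4}"
  shows "sum (sim_state y c) (neighbors (sim_edges V E A B) (Sw i k)) = 0"
    and "sum (sim_state y c) (neighbors (sim_edges V E A B) (Fx i k)) = -2"
proof -
  have fin: "finite {w \<in> V. P w}" for P using finite_verts by simp
  have "sum (sim_state y c) (neighbors (sim_edges V E A B) (Sw i k))
      = sum (sim_state y c) (Sw i ` cycle_nbrs k)"
    unfolding neighbors_sim_edges(3)[OF i k]
    by (subst sum.union_disjoint) (auto simp: fin sum_Inp_Gear cycle_nbrs_def)
  also have "\<dots> = 0"
    using i by (simp add: cycle_nbrs_def sim_state_simps)
  finally show "sum (sim_state y c) (neighbors (sim_edges V E A B) (Sw i k)) = 0" .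
  have "sum (sim_state y c) (neighbors (sim_edges V E A B) (Fx i k))
      = sum (sim_state y c) (Fx i ` cycle_nbrs k)"
    unfolding neighbors_sim_edges(4)[OF i k]
    by (subst sum.union_disjoint) (auto simp: fin sum_Inp_Gear cycle_nbrs_def)
  also have "\<dots> = -2"
    using i by (simp add: cycle_nbrs_def sim_state_simps)
  finally show "sum (sim_state y c) (neighbors (sim_edges V E A B) (Fx i k)) = -2" .
qed

text \<open>The bound shows that the neighbors in \<open>G\<close> cannot compensate a link
  contribution of \<open>-2d\<close>.\<close>

lemma abs_sum_neighbors_le:
  assumes "y \<in> configs V"
  shows "\<bar>sum y (neighbors E w)\<bar> \<le> int (degree E w)"
proof -
  have "\<bar>y j\<bar> \<le> 1" if "j \<in> neighbors E w" for j
    using assms that neighbors_subset by (fastforce simp: configs_def PiE_iff)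
  then have "(\<Sum>j\<in>neighbors E w. \<bar>y j\<bar>) \<le> (\<Sum>j\<in>neighbors E w. 1)"
    by (rule sum_mono)
  also have "\<dots> = int (degree E w)"
    by (simp add: degree_def)
  finally show ?thesis
    using sum_abs order_trans by blast
qed

section \<open>Dynamics of the simulator\<close>

lemma update_block_configs:
  assumes "y \<in> configs V"
  shows "update_block V E U y \<in> configs V"
  using assms by (auto simp: configs_def update_block_def q2r_rule_def PiE_iff)

text \<open>One parallel step acts on the two parameters alone: it updates one block of
  \<open>y\<close> and negates \<open>c\<close>.\<close>

lemma parallel_step_sim_state:
  assumes y: "y \<in> configs V" and c: "c \<in> {1, -1}"
  shows "parallel_step (sim_verts V E) (sim_edges V E A B) (sim_state y c)
    = sim_state (update_block V E (if c = 1 then A else B) y) (- c)"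
    (is "?L = sim_state ?z (- c)")
proof
  fix p
  let ?active = "\<lambda>w. w \<in> (if c = 1 then A else B)"
  \<comment> \<open>In the active class the link term vanishes. In the other it is
    \<open>-2d\<close>, and positivity of \<open>d\<close> gives \<open>d < 2d\<close>, so the sum
    is nonzero. Negating the sum over \<open>G\<close> changes neither case, hence
    \<open>Inp w\<close> and \<open>Gear w\<close> flip together.\<close>
  have active: "(sum y (neighbors E w) + int (degree E w) * ((if w \<in> A then c else - c) - 1) = 0)
        = (?active w \<and> sum y (neighbors E w) = 0)"
      "(- sum y (neighbors E w) + int (degree E w) * ((if w \<in> A then c else - c) - 1) = 0)
        = (?active w \<and> sum y (neighbors E w) = 0)" if w: "w \<in> V" for w
    using abs_sum_neighbors_le[OF y, of w] degree_pos[OF w] c w verts_split disj by auto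
  show "?L p = sim_state ?z (- c) p"
  proof (cases "p \<in> sim_verts V E")
    case False
    then show ?thesis by (simp add: parallel_step_def update_block_def sim_state_def)
  next
    case True
    then have L: "?L p = q2r_rule (sim_edges V E A B) p (sim_state y c)"
      by (simp add: parallel_step_def update_block_def)
    show ?thesis
    proof (cases p)
      case (Inp w)
      then have "w \<in> V" using True by (auto simp: sim_verts_def)
      then show ?thesis
        using L active(1)[OF \<open>w \<in> V\<close>] unfolding Inp
        by (simp add: q2r_rule_def sum_Inp_neighbors sim_state_simps update_block_def)
    next
      case (Gear w)
      then have "w \<in> V" using True by (auto simp: sim_verts_def)
      then show ?thesis
        using L active(2)[OF \<open>w \<in> V\<close>] unfolding Gear
        by (simp add: q2r_rule_def sum_Gear_neighbors sim_state_simps update_block_def)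
    next
      case (Sw i k)
      then have "i \<in> {1..alpha V E}" "k \<in> {1..4}" using True by (auto simp: sim_verts_def)
      then show ?thesis
        using L unfolding Sw by (simp add: q2r_rule_def sum_cycle_neighbors sim_state_simps)
    next
      case (Fx i k)
      then have "i \<in> {1..alpha V E}" "k \<in> {1..4}" using True by (auto simp: sim_verts_def)
      then show ?thesis
        using L unfolding Fx by (simp add: q2r_rule_def sum_cycle_neighbors sim_state_simps)
    qed
  qed
qed

text \<open>The first step has \<open>c = 1\<close> and updates \<open>A\<close>; the second has
  \<open>c = -1\<close>, updates \<open>B\<close> and restores \<open>c = 1\<close>.\<close>

lemma two_parallel_steps:
  assumes "y \<in> configs V"
  shows "(parallel_step (sim_verts V E) (sim_edges V E A B) ^^ 2) (sim_state y 1)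
    = sim_state (block_seq_step V E A B y) 1"
proof -
  have "parallel_step (sim_verts V E) (sim_edges V E A B) (sim_state y 1)
      = sim_state (update_block V E A y) (-1)"
    using parallel_step_sim_state[OF assms, of 1] by simp
  moreover have "parallel_step (sim_verts V E) (sim_edges V E A B)
      (sim_state (update_block V E A y) (-1)) = sim_state (block_seq_step V E A B y) 1"
    using parallel_step_sim_state[OF update_block_configs[OF assms], of "-1"]
    by (simp add: block_seq_step_def)
  ultimately show ?thesis by (simp add: numeral_2_eq_2)
qed

lemma block_seq_step_configs: "y \<in> configs V \<Longrightarrow> block_seq_step V E A B y \<in> configs V"
  by (simp add: block_seq_step_def update_block_configs)

text \<open>Membership in \<open>configs V\<close> is carried through the induction because
  \<open>two_parallel_steps\<close> requires it.\<close>

lemma simulation: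
  assumes "x \<in> configs V"
  shows "(block_seq_step V E A B ^^ T) x \<in> configs V \<and>
    (parallel_step (sim_verts V E) (sim_edges V E A B) ^^ (2 * T)) (sim_init V E x)
      = sim_state ((block_seq_step V E A B ^^ T) x) 1"
proof (induction T)
  case 0
  then show ?case using assms by (simp add: sim_init_eq)
next
  case (Suc T)
  \<comment> \<open>In this order \<open>funpow_add\<close> puts the two new steps outermost, where
    they act on the state given by the induction hypothesis.\<close>
  have "2 * Suc T = 2 + 2 * T" by simp
  then show ?case
    using Suc two_parallel_steps
    by (simp only: funpow_add o_apply funpow.simps block_seq_step_configs simp_thms)
qed

text \<open>Off \<open>V\<close> both sides are \<open>undefined\<close>, since configurations are
  extensional.\<close>

lemma restrict_input_sim_state:
  assumes "y \<in> configs V"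
  shows "restrict_input V (sim_state y c) = y"
  using assms
  by (auto simp: restrict_input_def sim_state_simps configs_def PiE_iff extensional_def fun_eq_iff)

end

theorem theorem1:
  fixes V A B :: "'v set" and E :: "'v set set"
  assumes "q2r_graph V E"
    and "even (card V)"
    and "\<forall>w\<in>V. degree E w > 0"
    and "V = A \<union> B" and "A \<inter> B = {}" and "A \<noteq> {}" and "B \<noteq> {}"
  shows "\<forall>x\<in>configs V. \<forall>T::nat.
    restrict_input V
      ((parallel_step (sim_verts V E) (sim_edges V E A B) ^^ (2 * T)) (sim_init V E x))
    = (block_seq_step V E A B ^^ T) x"
proof -
  interpret q2r_simulator V A B E
    using assms by unfold_locales auto
  show ?thesis by (simp add: simulation restrict_input_sim_state)
qed

end
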